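(* Let $N$ be a set of clauses over the signature of linear integer arithmetic with parameters, such that every term occurring in these clauses (as an argument of $\approx$, $<$ or $\le$, or nested inside such a term) is either (i) ground, or (ii) a variable, or (iii) a sum $\zeta+k$ of a variable $\zeta$ and a numeral $k\ge0$ that occurs on the right-hand side of a positive literal $s<\zeta+k$. If the set of ground terms occurring in $N$ is finite, then $N$ is satisfiable in linear integer arithmetic over $\mathbb{Z}$ if and only if $N$ is satisfiable with respect to the first-order theory of linear integer arithmetic.
   Context: The signature of linear integer arithmetic has one sort (integers), all integer numerals as constants, $+$, $-$, and the predicates $<$, $\le$ (and equality); it is extended by parameters, i.e. additional constants $\alpha,\beta,\dots$ that may be interpreted arbitrarily. Clauses are finite disjunctions of literals (atoms $s\approx t$, $s<t$, $s\le t$ or their negations), with variables implicitly universally quantified. $N$ is satisfiable in LIA over $\mathbb{Z}$ if there is an assignment of integers to the parameters such that, in the standard integers, every clause of $N$ is true for all integer values of its variables. $N$ is satisfiable with respect to the first-order theory of LIA if there is a structure (with arbitrary interpretation of the parameters) satisfying all first-order sentences over the arithmetic signature that are true in $\mathbb{Z}$, in which every clause of $N$ is true for all values of its variables. $N$ may be infinite. *)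

theory Defs
  imports Main "HOL-Library.Infinite_Typeclass"
begin

section \<open>Syntax\<close>

text \<open>The type parameter \<open>'p\<close> is the type of names of parameters.  The generated set functions
  \<open>pars_trm\<close> and \<open>pars_fm\<close> collect the parameters of a term or formula.\<close>

datatype (pars_trm: 'p) trm =
    Var nat
  | Num int
  | Par 'p
  | Add "'p trm" "'p trm"
  | Sub "'p trm" "'p trm"

datatype (pars_atom: 'p) atom =
    Eq "'p trm" "'p trm"
  | Less "'p trm" "'p trm"
  | Le "'p trm" "'p trm"

datatype 'p literal = Pos "'p atom" | Neg "'p atom"

type_synonym 'p clause = "'p literal list"

datatype (pars_fm: 'p) fm =
    Atom "'p atom"
  | FNot "'p fm"
  | FAnd "'p fm" "'p fm"
  | FOr "'p fm" "'p fm"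
  | FAll nat "'p fm"
  | FEx nat "'p fm"

primrec vars_trm :: "'p trm \<Rightarrow> nat set" where
  "vars_trm (Var x) = {x}"
| "vars_trm (Num k) = {}"
| "vars_trm (Par a) = {}"
| "vars_trm (Add s t) = vars_trm s \<union> vars_trm t"
| "vars_trm (Sub s t) = vars_trm s \<union> vars_trm t"

primrec vars_atom :: "'p atom \<Rightarrow> nat set" where
  "vars_atom (Eq s t) = vars_trm s \<union> vars_trm t"
| "vars_atom (Less s t) = vars_trm s \<union> vars_trm t"
| "vars_atom (Le s t) = vars_trm s \<union> vars_trm t"

primrec free_vars :: "'p fm \<Rightarrow> nat set" where
  "free_vars (Atom A) = vars_atom A"
| "free_vars (FNot F) = free_vars F"
| "free_vars (FAnd F G) = free_vars F \<union> free_vars G"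
| "free_vars (FOr F G) = free_vars F \<union> free_vars G"
| "free_vars (FAll x F) = free_vars F - {x}"
| "free_vars (FEx x F) = free_vars F - {x}"

text \<open>Parameters do not belong to the arithmetic signature.\<close>

definition arith_sentence :: "'p fm \<Rightarrow> bool" where
  "arith_sentence F \<longleftrightarrow> free_vars F = {} \<and> pars_fm F = {}"


section \<open>Semantics\<close>

text \<open>The universe of a structure is a subset of a type, and equality is interpreted as identity.\<close>

record ('p, 'd) struct =
  universe :: "'d set"
  num_of :: "int \<Rightarrow> 'd"
  par_of :: "'p \<Rightarrow> 'd"
  add_of :: "'d \<Rightarrow> 'd \<Rightarrow> 'd"
  sub_of :: "'d \<Rightarrow> 'd \<Rightarrow> 'd"
  less_of :: "'d \<Rightarrow> 'd \<Rightarrow> bool"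
  le_of :: "'d \<Rightarrow> 'd \<Rightarrow> bool"

definition wf_struct :: "('p, 'd) struct \<Rightarrow> bool" where
  "wf_struct S \<longleftrightarrow>
     universe S \<noteq> {} \<and>
     (\<forall>k. num_of S k \<in> universe S) \<and>
     (\<forall>a. par_of S a \<in> universe S) \<and>
     (\<forall>x\<in>universe S. \<forall>y\<in>universe S. add_of S x y \<in> universe S) \<and>
     (\<forall>x\<in>universe S. \<forall>y\<in>universe S. sub_of S x y \<in> universe S)"

definition int_struct :: "('p \<Rightarrow> int) \<Rightarrow> ('p, int) struct" where
  "int_struct \<pi> =
     \<lparr> universe = UNIV, num_of = (\<lambda>k. k), par_of = \<pi>,
       add_of = (+), sub_of = (-), less_of = (<), le_of = (\<le>) \<rparr>"

primrec eval :: "('p, 'd) struct \<Rightarrow> (nat \<Rightarrow> 'd) \<Rightarrow> 'p trm \<Rightarrow> 'd" where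
  "eval S \<sigma> (Var x) = \<sigma> x"
| "eval S \<sigma> (Num k) = num_of S k"
| "eval S \<sigma> (Par a) = par_of S a"
| "eval S \<sigma> (Add s t) = add_of S (eval S \<sigma> s) (eval S \<sigma> t)"
| "eval S \<sigma> (Sub s t) = sub_of S (eval S \<sigma> s) (eval S \<sigma> t)"

primrec sat_atom :: "('p, 'd) struct \<Rightarrow> (nat \<Rightarrow> 'd) \<Rightarrow> 'p atom \<Rightarrow> bool" where
  "sat_atom S \<sigma> (Eq s t) \<longleftrightarrow> eval S \<sigma> s = eval S \<sigma> t"
| "sat_atom S \<sigma> (Less s t) \<longleftrightarrow> less_of S (eval S \<sigma> s) (eval S \<sigma> t)"
| "sat_atom S \<sigma> (Le s t) \<longleftrightarrow> le_of S (eval S \<sigma> s) (eval S \<sigma> t)"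

primrec sat_lit :: "('p, 'd) struct \<Rightarrow> (nat \<Rightarrow> 'd) \<Rightarrow> 'p literal \<Rightarrow> bool" where
  "sat_lit S \<sigma> (Pos A) \<longleftrightarrow> sat_atom S \<sigma> A"
| "sat_lit S \<sigma> (Neg A) \<longleftrightarrow> \<not> sat_atom S \<sigma> A"

primrec sat_fm :: "('p, 'd) struct \<Rightarrow> (nat \<Rightarrow> 'd) \<Rightarrow> 'p fm \<Rightarrow> bool" where
  "sat_fm S \<sigma> (Atom A) \<longleftrightarrow> sat_atom S \<sigma> A"
| "sat_fm S \<sigma> (FNot F) \<longleftrightarrow> \<not> sat_fm S \<sigma> F"
| "sat_fm S \<sigma> (FAnd F G) \<longleftrightarrow> sat_fm S \<sigma> F \<and> sat_fm S \<sigma> G"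
| "sat_fm S \<sigma> (FOr F G) \<longleftrightarrow> sat_fm S \<sigma> F \<or> sat_fm S \<sigma> G"
| "sat_fm S \<sigma> (FAll x F) \<longleftrightarrow> (\<forall>d\<in>universe S. sat_fm S (\<sigma>(x := d)) F)"
| "sat_fm S \<sigma> (FEx x F) \<longleftrightarrow> (\<exists>d\<in>universe S. sat_fm S (\<sigma>(x := d)) F)"

definition valuations :: "('p, 'd) struct \<Rightarrow> (nat \<Rightarrow> 'd) set" where
  "valuations S = {\<sigma>. \<forall>x. \<sigma> x \<in> universe S}"

definition true_clause :: "('p, 'd) struct \<Rightarrow> 'p clause \<Rightarrow> bool" where
  "true_clause S C \<longleftrightarrow> (\<forall>\<sigma>\<in>valuations S. \<exists>L\<in>set C. sat_lit S \<sigma> L)"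

definition true_fm :: "('p, 'd) struct \<Rightarrow> 'p fm \<Rightarrow> bool" where
  "true_fm S F \<longleftrightarrow> (\<forall>\<sigma>\<in>valuations S. sat_fm S \<sigma> F)"

definition satisfiable_int :: "'p clause set \<Rightarrow> bool" where
  "satisfiable_int N \<longleftrightarrow> (\<exists>\<pi>. \<forall>C\<in>N. true_clause (int_struct \<pi>) C)"

text \<open>For an arithmetic sentence \<open>F\<close> the choice of \<open>\<pi>\<close> below is immaterial.\<close>

definition models_LIA_theory :: "('p, 'd) struct \<Rightarrow> bool" where
  "models_LIA_theory S \<longleftrightarrow>
     (\<forall>F. arith_sentence F \<and> (\<forall>\<pi>. true_fm (int_struct \<pi>) F) \<longrightarrow> true_fm S F)"

text \<open>HOL cannot quantify over types inside a formula, so the type \<open>'d\<close> from which universes are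
  taken is a parameter; a statement about it is meant for every \<open>'d\<close>.  Restricting \<open>'d\<close> to
  infinite types loses nothing: every model of the theory of linear integer arithmetic is infinite.\<close>

definition satisfiable_theory :: "'d::infinite itself \<Rightarrow> 'p clause set \<Rightarrow> bool" where
  "satisfiable_theory _ N \<longleftrightarrow>
     (\<exists>S :: ('p, 'd) struct.
        wf_struct S \<and> models_LIA_theory S \<and> (\<forall>C\<in>N. true_clause S C))"


section \<open>The clause fragment\<close>

primrec subterms :: "'p trm \<Rightarrow> 'p trm set" where
  "subterms (Var x) = {Var x}"
| "subterms (Num k) = {Num k}"
| "subterms (Par a) = {Par a}"
| "subterms (Add s t) = insert (Add s t) (subterms s \<union> subterms t)"
| "subterms (Sub s t) = insert (Sub s t) (subterms s \<union> subterms t)"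

primrec terms_atom :: "'p atom \<Rightarrow> 'p trm set" where
  "terms_atom (Eq s t) = subterms s \<union> subterms t"
| "terms_atom (Less s t) = subterms s \<union> subterms t"
| "terms_atom (Le s t) = subterms s \<union> subterms t"

primrec terms_lit :: "'p literal \<Rightarrow> 'p trm set" where
  "terms_lit (Pos A) = terms_atom A"
| "terms_lit (Neg A) = terms_atom A"

definition ground :: "'p trm \<Rightarrow> bool" where
  "ground t \<longleftrightarrow> vars_trm t = {}"

definition ground_terms :: "'p clause set \<Rightarrow> 'p trm set" where
  "ground_terms N = {t. ground t \<and> (\<exists>C\<in>N. \<exists>L\<in>set C. t \<in> terms_lit L)}"

text \<open>Whether a term \<open>\<zeta> + k\<close> is admitted depends on its occurrence: the flag \<open>b\<close> says that \<open>t\<close> is the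
  right-hand side of a positive literal \<open>s < t\<close>, and then \<open>t\<close> itself may be \<open>\<zeta> + k\<close>.\<close>

definition admissible_arg :: "bool \<Rightarrow> 'p trm \<Rightarrow> bool" where
  "admissible_arg b t \<longleftrightarrow>
     (\<forall>u\<in>subterms t.
        ground u \<or>
        (\<exists>x. u = Var x) \<or>
        (b \<and> u = t \<and> (\<exists>x k. k \<ge> 0 \<and> u = Add (Var x) (Num k))))"

text \<open>Here \<open>pos\<close> is the polarity of the literal in which the atom occurs.\<close>

primrec admissible_atom :: "bool \<Rightarrow> 'p atom \<Rightarrow> bool" where
  "admissible_atom pos (Eq s t) \<longleftrightarrow> admissible_arg False s \<and> admissible_arg False t"
| "admissible_atom pos (Less s t) \<longleftrightarrow> admissible_arg False s \<and> admissible_arg pos t"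
| "admissible_atom pos (Le s t) \<longleftrightarrow> admissible_arg False s \<and> admissible_arg False t"

primrec admissible_lit :: "'p literal \<Rightarrow> bool" where
  "admissible_lit (Pos A) \<longleftrightarrow> admissible_atom True A"
| "admissible_lit (Neg A) \<longleftrightarrow> admissible_atom False A"

definition admissible_clause :: "'p clause \<Rightarrow> bool" where
  "admissible_clause C \<longleftrightarrow> (\<forall>L\<in>set C. admissible_lit L)"

end

theory Submission imports Defs "HOL-Library.Nat_Bijection" begin

text \<open>From integers to the theory, transport the standard model along an injection into the given
  infinite type.  Conversely, let \<open>S\<close> be a model of the theory and \<open>G\<close> the finite set of ground terms.
  Whenever two elements of \<open>G\<close> differ in \<open>S\<close> by a standard integer, record that integer; otherwise
  record only which of the two is smaller.  These finitely many ground facts have a solution \<open>\<pi>\<close> in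
  \<open>\<int>\<close>, and for it no distance between elements of \<open>G\<close> is larger than in \<open>S\<close>.  Hence sending the
  integer value of each \<open>t \<in> G\<close> to its value in \<open>S\<close> extends to a map \<open>f : \<int> \<rightarrow> S\<close> with
  \<open>f z + (w - z) \<le> f w\<close> for \<open>z \<le> w\<close>.  Such a map preserves the falsity of every admissible literal,
  a false \<open>s < \<zeta> + k\<close> being the constraint \<open>\<zeta> + k \<le> s\<close>; so a clause true in \<open>S\<close> is true in \<open>\<int>\<close>.\<close>

section \<open>Isomorphic copies of the standard model\<close>

text \<open>The universe is only the range of \<open>h\<close>, since \<open>'d\<close> may be
  uncountable. For injective \<open>h\<close>, \<open>inv h\<close> undoes \<open>h\<close>, so
  \<open>h\<close> is an isomorphism onto this structure.\<close>

definition copy_struct :: "(int \<Rightarrow> 'd) \<Rightarrow> ('p \<Rightarrow> int) \<Rightarrow> ('p, 'd) struct" where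
  "copy_struct h \<pi> =
     \<lparr> universe = range h, num_of = h, par_of = h \<circ> \<pi>,
       add_of = (\<lambda>x y. h (inv h x + inv h y)), sub_of = (\<lambda>x y. h (inv h x - inv h y)),
       less_of = (\<lambda>x y. inv h x < inv h y), le_of = (\<lambda>x y. inv h x \<le> inv h y) \<rparr>"

lemma wf_copy_struct: "wf_struct (copy_struct h \<pi>)"
  by (auto simp: wf_struct_def copy_struct_def)

lemma eval_copy_struct:
  "inj h \<Longrightarrow> eval (copy_struct h \<pi>) (h \<circ> \<sigma>) t = h (eval (int_struct \<pi>) \<sigma> t)"
  by (induction t) (simp_all add: copy_struct_def int_struct_def)

lemma sat_atom_copy_struct:
  "inj h \<Longrightarrow> sat_atom (copy_struct h \<pi>) (h \<circ> \<sigma>) A \<longleftrightarrow> sat_atom (int_struct \<pi>) \<sigma> A"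
  by (cases A) (simp_all add: eval_copy_struct inj_eq, simp_all add: copy_struct_def int_struct_def)

lemma sat_lit_copy_struct:
  "inj h \<Longrightarrow> sat_lit (copy_struct h \<pi>) (h \<circ> \<sigma>) L \<longleftrightarrow> sat_lit (int_struct \<pi>) \<sigma> L"
  by (cases L) (simp_all add: sat_atom_copy_struct)

lemma sat_fm_copy_struct:
  assumes "inj h"
  shows "sat_fm (copy_struct h \<pi>) (h \<circ> \<sigma>) F \<longleftrightarrow> sat_fm (int_struct \<pi>) \<sigma> F"
proof -
  have U: "universe (copy_struct h \<pi>) = range h" "universe (int_struct \<pi>) = UNIV"
    by (simp_all add: copy_struct_def int_struct_def)
  show ?thesis
    \<comment> \<open>A quantifier over \<open>range h\<close> picks some \<open>h z\<close>, and
      \<open>(h \<circ> \<sigma>)(x := h z)\<close> is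
      \<open>h \<circ> \<sigma>(x := z)\<close>.\<close>
    by (induction F arbitrary: \<sigma>) (simp_all add: sat_atom_copy_struct assms U flip: fun_upd_comp)
qed

lemma valuations_copy_struct: "valuations (copy_struct h \<pi>) = range (\<lambda>\<sigma>. h \<circ> \<sigma>)"
proof -
  have "\<exists>\<sigma>'. \<sigma> = h \<circ> \<sigma>'" if "\<forall>x. \<sigma> x \<in> range h" for \<sigma> :: "nat \<Rightarrow> _"
    using that by (intro exI[of _ "\<lambda>x. inv h (\<sigma> x)"]) (auto simp: fun_eq_iff f_inv_into_f)
  then show ?thesis
    by (fastforce simp: valuations_def copy_struct_def)
qed

lemma valuations_int_struct [simp]: "valuations (int_struct \<pi>) = UNIV"
  by (simp add: valuations_def int_struct_def)

lemma satisfiable_int_imp_satisfiable_theory: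
  assumes "satisfiable_int (N :: 'p clause set)"
  shows "satisfiable_theory TYPE('d::infinite) N"
proof -
  obtain \<pi> :: "'p \<Rightarrow> int" where \<pi>: "\<forall>C\<in>N. true_clause (int_struct \<pi>) C"
    using assms by (auto simp: satisfiable_int_def)
  obtain h0 :: "nat \<Rightarrow> 'd" where "inj h0"
    using infinite_countable_subset[OF infinite_UNIV] by blast
  define h where "h = h0 \<circ> int_encode"
  have h: "inj h"
    using \<open>inj h0\<close> by (simp add: h_def inj_compose inj_int_encode)
  show ?thesis
    unfolding satisfiable_theory_def
  proof (intro exI conjI)
    show "wf_struct (copy_struct h \<pi>)"
      by (rule wf_copy_struct)
    show "models_LIA_theory (copy_struct h \<pi>)"
      by (auto simp: models_LIA_theory_def true_fm_def valuations_copy_struct sat_fm_copy_struct h)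
    show "\<forall>C\<in>N. true_clause (copy_struct h \<pi>) C"
      using \<pi> by (auto simp: true_clause_def valuations_copy_struct sat_lit_copy_struct h)
  qed
qed


section \<open>Transfer to models of the theory\<close>

lemma finite_free_vars: "finite (free_vars F)"
proof -
  have trm: "finite (vars_trm t)" for t :: "'a trm"
    by (induction t) auto
  have atom: "finite (vars_atom A)" for A :: "'a atom"
    by (cases A) (auto simp: trm)
  show ?thesis
    by (induction F) (auto simp: atom)
qed

lemma finite_pars_atom: "finite (pars_atom A)"
proof -
  have trm: "finite (pars_trm t)" for t :: "'a trm"
    by (induction t) auto
  show ?thesis
    by (cases A) (auto simp: trm)
qed

lemma free_vars_foldr_FAll: "free_vars (foldr FAll xs F) = free_vars F - set xs"
  by (induction xs) auto

lemma pars_fm_foldr_FAll [simp]: "pars_fm (foldr FAll xs F) = pars_fm F"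
  by (induction xs) auto

lemma sat_fm_foldr_FAllD:
  assumes "sat_fm S \<sigma> (foldr FAll xs F)" and "\<sigma> \<in> valuations S"
  shows "sat_fm S \<sigma> F"
  using assms
proof (induction xs)
  case (Cons x xs)
  \<comment> \<open>The quantifier is instantiated with the current value of \<open>x\<close>; the
    trivial update is kept so that it matches the unfolded quantifier.\<close>
  then have "sat_fm S (\<sigma>(x := \<sigma> x)) (foldr FAll xs F)"
    unfolding valuations_def by (simp del: fun_upd_triv)
  with Cons show ?case by simp
qed simp

lemma sat_fm_int_foldr_FAll:
  assumes "\<And>\<sigma>. sat_fm (int_struct \<pi>) \<sigma> F"
  shows "sat_fm (int_struct \<pi>) \<sigma> (foldr FAll xs F)"
  by (induction xs arbitrary: \<sigma>) (simp_all add: assms)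

text \<open>Arithmetic sentences contain no parameters, so facts about parameters can be transferred
  only with variables in their place. The atoms translated below are ground, so new variables cannot
  clash with old ones.\<close>

primrec abs_trm :: "('p \<Rightarrow> nat) \<Rightarrow> 'p trm \<Rightarrow> 'p trm" where
  "abs_trm e (Var x) = Var x"
| "abs_trm e (Num k) = Num k"
| "abs_trm e (Par a) = Var (e a)"
| "abs_trm e (Add s t) = Add (abs_trm e s) (abs_trm e t)"
| "abs_trm e (Sub s t) = Sub (abs_trm e s) (abs_trm e t)"

primrec abs_atom :: "('p \<Rightarrow> nat) \<Rightarrow> 'p atom \<Rightarrow> 'p atom" where
  "abs_atom e (Eq s t) = Eq (abs_trm e s) (abs_trm e t)"
| "abs_atom e (Less s t) = Less (abs_trm e s) (abs_trm e t)"
| "abs_atom e (Le s t) = Le (abs_trm e s) (abs_trm e t)"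

lemma pars_abs_atom: "pars_atom (abs_atom e A) = {}"
proof -
  have trm: "pars_trm (abs_trm e t) = {}" for t
    by (induction t) auto
  show ?thesis
    by (cases A) (auto simp: trm)
qed

lemma eval_abs_trm:
  assumes "vars_trm t = {}" and "\<forall>a\<in>pars_trm t. \<sigma> (e a) = par_of S a"
  shows "eval S \<sigma> (abs_trm e t) = eval S \<tau> t"
  using assms by (induction t) auto

lemma sat_abs_atom:
  assumes "vars_atom A = {}" and "\<forall>a\<in>pars_atom A. \<sigma> (e a) = par_of S a"
  shows "sat_atom S \<sigma> (abs_atom e A) \<longleftrightarrow> sat_atom S \<tau> A"
  using assms by (cases A) (auto simp: eval_abs_trm[where \<tau> = \<tau>])

lemma sat_abs_atom_int:
  assumes "vars_atom A = {}"
  shows "sat_atom (int_struct \<pi>) \<sigma> (abs_atom e A) \<longleftrightarrow> sat_atom (int_struct (\<sigma> \<circ> e)) \<tau> A"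
proof -
  have "eval (int_struct \<pi>) \<sigma> (abs_trm e t) = eval (int_struct (\<sigma> \<circ> e)) \<tau> t"
    if "vars_trm t = {}" for t
    using that by (induction t) (auto simp: int_struct_def)
  with assms show ?thesis
    by (cases A) (auto simp: int_struct_def)
qed

text \<open>The syntax has no constant for truth; \<open>0 = 0\<close> serves as the empty
  conjunction.\<close>

definition conj_atoms :: "'p atom list \<Rightarrow> 'p fm" where
  "conj_atoms As = foldr (\<lambda>A F. FAnd (Atom A) F) As (Atom (Eq (Num 0) (Num 0)))"

lemma sat_conj_atoms: "sat_fm S \<sigma> (conj_atoms As) \<longleftrightarrow> (\<forall>A\<in>set As. sat_atom S \<sigma> A)"
  unfolding conj_atoms_def by (induction As) auto

lemma pars_conj_atoms: "pars_fm (conj_atoms As) = (\<Union>A\<in>set As. pars_atom A)"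
  unfolding conj_atoms_def by (induction As) auto

locale LIA_model =
  fixes S :: "('p, 'd) struct"
  assumes wf: "wf_struct S" and models: "models_LIA_theory S"
begin

lemma num_in [simp]: "num_of S k \<in> universe S"
  and par_in [simp]: "par_of S a \<in> universe S"
  and add_in [simp]: "x \<in> universe S \<Longrightarrow> y \<in> universe S \<Longrightarrow> add_of S x y \<in> universe S"
  and sub_in [simp]: "x \<in> universe S \<Longrightarrow> y \<in> universe S \<Longrightarrow> sub_of S x y \<in> universe S"
  using wf by (auto simp: wf_struct_def)

lemma eval_in: "\<sigma> \<in> valuations S \<Longrightarrow> eval S \<sigma> t \<in> universe S"
  by (induction t) (auto simp: valuations_def)

text \<open>The theory consists of sentences, so an open formula is passed through its universal
  closure.\<close>

lemma transfer:
  assumes "pars_fm F = {}" and "\<And>\<pi> \<sigma>. sat_fm (int_struct \<pi>) \<sigma> F" and "\<sigma> \<in> valuations S"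
  shows "sat_fm S \<sigma> F"
proof -
  obtain xs where xs: "set xs = free_vars F"
    using finite_list[OF finite_free_vars] by blast
  have "arith_sentence (foldr FAll xs F)"
    by (simp add: arith_sentence_def free_vars_foldr_FAll xs assms)
  moreover have "\<forall>\<pi>. true_fm (int_struct \<pi>) (foldr FAll xs F)"
    by (simp add: true_fm_def sat_fm_int_foldr_FAll assms)
  ultimately have "true_fm S (foldr FAll xs F)"
    using models by (auto simp: models_LIA_theory_def)
  with assms(3) show ?thesis
    by (auto simp: true_fm_def intro: sat_fm_foldr_FAllD)
qed

text \<open>If no integer values worked, the negated conjunction with parameters read as variables
  would be valid in the integers, hence in \<open>S\<close>; but the parameter values of
  \<open>S\<close> refute it. Finiteness makes it one formula.\<close>

lemma ground_atoms_satisfiable_int: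
  assumes fin: "finite \<A>" and ground: "\<And>A. A \<in> \<A> \<Longrightarrow> vars_atom A = {}"
    and sat: "\<And>A. A \<in> \<A> \<Longrightarrow> sat_atom S \<tau> A"
  obtains \<pi> where "\<And>A \<sigma>. A \<in> \<A> \<Longrightarrow> sat_atom (int_struct \<pi>) \<sigma> A"
proof -
  define P where "P = (\<Union>A\<in>\<A>. pars_atom A)"
  have "finite P"
    using fin by (simp add: P_def finite_pars_atom)
  then obtain e :: "'p \<Rightarrow> nat" where e: "inj_on e P"
    using finite_imp_inj_to_nat_seg by blast
  obtain As where As: "set As = \<A>"
    using finite_list[OF fin] by blast
  define F where "F = FNot (conj_atoms (map (abs_atom e) As))"
  \<comment> \<open>Each variable gets the \<open>S\<close>-value of the parameter it replaces. Off
    the image of \<open>e\<close> the choice of parameter is arbitrary, yet its value still lies in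
    the universe.\<close>
  define \<sigma> where "\<sigma> n = par_of S (inv_into P e n)" for n
  have "sat_atom S \<sigma> (abs_atom e A)" if "A \<in> \<A>" for A
  proof -
    have "\<forall>a\<in>pars_atom A. \<sigma> (e a) = par_of S a"
      using that by (auto simp: \<sigma>_def P_def intro!: arg_cong[of _ _ "par_of S"] inv_into_f_f e[unfolded P_def])
    with that show ?thesis
      using sat_abs_atom[of A \<sigma> e S \<tau>] ground sat by blast
  qed
  then have "\<not> sat_fm S \<sigma> F"
    by (simp add: F_def sat_conj_atoms As)
  moreover have "\<sigma> \<in> valuations S"
    by (simp add: \<sigma>_def valuations_def)
  moreover have "pars_fm F = {}"
    by (simp add: F_def pars_conj_atoms pars_abs_atom)
  ultimately obtain \<pi> \<rho> where "\<not> sat_fm (int_struct \<pi>) \<rho> F"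
    using transfer by blast
  then have "sat_atom (int_struct \<pi>) \<rho> (abs_atom e A)" if "A \<in> \<A>" for A
    using that by (simp add: F_def sat_conj_atoms As)
  then show thesis
    using that ground sat_abs_atom_int by metis
qed

lemma transfer_three:
  assumes "x \<in> universe S" "y \<in> universe S" "z \<in> universe S"
    and "pars_fm F = {}" and "\<And>\<pi> \<sigma>. sat_fm (int_struct \<pi>) \<sigma> F"
  shows "sat_fm S (\<lambda>n. if n = 0 then x else if n = 1 then y else z) F"
  using assms by (intro transfer) (auto simp: valuations_def)

section \<open>Order and numeral arithmetic inside a model of the theory\<close>

lemma add_num_add_num:
  assumes "x \<in> universe S"
  shows "add_of S (add_of S x (num_of S i)) (num_of S j) = add_of S x (num_of S (i + j))"
  using transfer_three[OF assms assms assms,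
      of "Atom (Eq (Add (Add (Var 0) (Num i)) (Num j)) (Add (Var 0) (Num (i + j))))"]
  by (simp add: int_struct_def)

lemma add_num_0: "x \<in> universe S \<Longrightarrow> add_of S x (num_of S 0) = x"
  using transfer_three[of x x x "Atom (Eq (Add (Var 0) (Num 0)) (Var 0))"]
  by (simp add: int_struct_def)

lemma not_less_iff:
  assumes "x \<in> universe S" "y \<in> universe S"
  shows "\<not> less_of S x y \<longleftrightarrow> le_of S y x"
proof -
  let ?less = "Atom (Less (Var 0) (Var 1))" and ?le = "Atom (Le (Var 1) (Var 0))"
  have "sat_fm S (\<lambda>n. if n = 0 then x else if n = 1 then y else y)
    (FOr (FAnd ?less (FNot ?le)) (FAnd (FNot ?less) ?le))"
    using assms by (intro transfer_three) (auto simp: int_struct_def)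
  then show ?thesis
    by auto
qed

lemma le_antisym: "x \<in> universe S \<Longrightarrow> y \<in> universe S \<Longrightarrow> le_of S x y \<Longrightarrow> le_of S y x \<Longrightarrow> x = y"
  using transfer_three[of x y y "FOr (FNot (Atom (Le (Var 0) (Var 1))))
     (FOr (FNot (Atom (Le (Var 1) (Var 0)))) (Atom (Eq (Var 0) (Var 1))))"]
  by (auto simp: int_struct_def)

lemma le_refl: "x \<in> universe S \<Longrightarrow> le_of S x x"
  using transfer_three[of x x x "Atom (Le (Var 0) (Var 0))"]
  by (auto simp: int_struct_def)

lemma less_imp_le: "x \<in> universe S \<Longrightarrow> y \<in> universe S \<Longrightarrow> less_of S x y \<Longrightarrow> le_of S x y"
  using transfer_three[of x y y "FOr (FNot (Atom (Less (Var 0) (Var 1)))) (Atom (Le (Var 0) (Var 1)))"]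
  by (auto simp: int_struct_def)

lemma le_trans:
  assumes "x \<in> universe S" "y \<in> universe S" "z \<in> universe S" "le_of S x y" "le_of S y z"
  shows "le_of S x z"
  using transfer_three[OF assms(1-3), of "FOr (FNot (Atom (Le (Var 0) (Var 1))))
     (FOr (FNot (Atom (Le (Var 1) (Var 2)))) (Atom (Le (Var 0) (Var 2))))"] assms
  by (auto simp: int_struct_def)

lemma less_if_add_num_le:
  assumes "x \<in> universe S" "y \<in> universe S" "k > 0" "le_of S (add_of S x (num_of S k)) y"
  shows "less_of S x y"
  using transfer_three[OF assms(1,2,2), of "FOr (FNot (Atom (Le (Add (Var 0) (Num k)) (Var 1))))
     (Atom (Less (Var 0) (Var 1)))"] assms
  by (auto simp: int_struct_def)

lemma add_num_mono:
  assumes "x \<in> universe S" "y \<in> universe S" "le_of S x y"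
  shows "le_of S (add_of S x (num_of S k)) (add_of S y (num_of S k))"
  using transfer_three[OF assms(1,2,2), of "FOr (FNot (Atom (Le (Var 0) (Var 1))))
     (Atom (Le (Add (Var 0) (Num k)) (Add (Var 1) (Num k))))"] assms
  by (auto simp: int_struct_def)

text \<open>Discreteness of the order, in the form of one descent step for
  \<open>standard_difference\<close>.\<close>

lemma less_add_num_Suc:
  assumes "x \<in> universe S" "y \<in> universe S" "less_of S y (add_of S x (num_of S (k + 1)))"
  shows "less_of S y (add_of S x (num_of S k)) \<or> y = add_of S x (num_of S k)"
proof -
  have "sat_fm S (\<lambda>n. if n = 0 then x else if n = 1 then y else y)
    (FOr (FNot (Atom (Less (Var 1) (Add (Var 0) (Num (k + 1))))))
      (FOr (Atom (Less (Var 1) (Add (Var 0) (Num k)))) (Atom (Eq (Var 1) (Add (Var 0) (Num k))))))"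
    using assms by (intro transfer_three) (auto simp: int_struct_def)
  with assms show ?thesis
    by auto
qed

text \<open>Descend from \<open>x + k\<close> one unit at a time: either \<open>y\<close> is hit, or
  the strict upper bound drops, and it cannot drop to \<open>x\<close> because
  \<open>x \<le> y\<close>.\<close>

lemma standard_difference:
  assumes x: "x \<in> universe S" and y: "y \<in> universe S" and le: "le_of S x y"
    and less: "less_of S y (add_of S x (num_of S k))" and k: "k \<ge> 0"
  shows "\<exists>n. add_of S x (num_of S n) = y"
  using k less
proof (induction k rule: int_ge_induct)
  case base
  with x y le not_less_iff[OF y x] show ?case
    by (simp add: add_num_0)
next
  case (step k)
  then show ?case
    using less_add_num_Suc[OF x y] by blast
qed


section \<open>Pulling back to the integers\<close>

text \<open>Standard distances are reproduced exactly; any other positive distance in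
  \<open>S\<close> exceeds all numerals. The name \<open>d\<close> lets a simplified value such as 0
  be supplied.\<close>

lemma contracting_parameters:
  assumes fin: "finite G" and ground: "\<And>t. t \<in> G \<Longrightarrow> ground t" and \<tau>: "\<tau> \<in> valuations S"
  obtains \<pi> where "\<And>s t \<sigma> d. s \<in> G \<Longrightarrow> t \<in> G \<Longrightarrow> d = eval (int_struct \<pi>) \<sigma> t - eval (int_struct \<pi>) \<sigma> s \<Longrightarrow>
    d \<ge> 0 \<Longrightarrow> le_of S (add_of S (eval S \<tau> s) (num_of S d)) (eval S \<tau> t)"
proof -
  let ?e = "eval S \<tau>"
  define std where "std s t n \<longleftrightarrow> add_of S (?e s) (num_of S n) = ?e t" for s t n
  define diff_atom where "diff_atom s t =
    (if \<exists>n. std s t n then Eq (Add s (Num (SOME n. std s t n))) t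
     else if less_of S (?e s) (?e t) then Less s t else Less t s)" for s t
  have U [simp]: "?e t \<in> universe S" for t
    using \<tau> by (rule eval_in)
  have 1: "finite (case_prod diff_atom ` (G \<times> G))"
    using fin by simp
  have 2: "vars_atom A = {}" if "A \<in> case_prod diff_atom ` (G \<times> G)" for A
    using that ground by (auto simp: diff_atom_def ground_def split: if_splits)
  have 3: "sat_atom S \<tau> A" if "A \<in> case_prod diff_atom ` (G \<times> G)" for A
  proof -
    have "sat_atom S \<tau> (diff_atom s t)" for s t
    proof (cases "\<exists>n. std s t n")
      case True
      then have "std s t (SOME n. std s t n)" by (rule someI_ex)
      with True show ?thesis
        by (simp add: diff_atom_def std_def[of s t "Eps (std s t)"])
    next
      case False
      \<comment> \<open>Distance 0 is standard, so equal values fall under the first case.\<close>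
      then have "?e s \<noteq> ?e t"
        using add_num_0[of "?e s"] by (auto simp: std_def)
      then have "less_of S (?e s) (?e t) \<or> less_of S (?e t) (?e s)"
        by (metis not_less_iff le_antisym U)
      with False show ?thesis
        by (auto simp: diff_atom_def)
    qed
    with that show ?thesis by auto
  qed
  obtain \<pi> where \<pi>: "\<And>A \<sigma>. A \<in> case_prod diff_atom ` (G \<times> G) \<Longrightarrow> sat_atom (int_struct \<pi>) \<sigma> A"
    using ground_atoms_satisfiable_int[OF 1 2 3] by blast
  show thesis
  proof (rule that)
    fix s t \<sigma> d
    assume G: "s \<in> G" "t \<in> G" and d: "d = eval (int_struct \<pi>) \<sigma> t - eval (int_struct \<pi>) \<sigma> s" "d \<ge> 0"
    have sat: "sat_atom (int_struct \<pi>) \<sigma> (diff_atom s t)"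
      using G by (intro \<pi>) auto
    show "le_of S (add_of S (?e s) (num_of S d)) (?e t)"
    proof (cases "\<exists>n. std s t n")
      case True
      then have "std s t (SOME n. std s t n)" by (rule someI_ex)
      \<comment> \<open>The recorded equation holds under \<open>\<pi>\<close> and determines the
        integer distance.\<close>
      moreover have "(SOME n. std s t n) = d"
        using sat True d by (simp add: diff_atom_def int_struct_def)
      ultimately show ?thesis
        by (simp add: std_def le_refl)
    next
      case False
      \<comment> \<open>Since \<open>d \<ge> 0\<close>, the recorded atom cannot be
        \<open>Less t s\<close>.\<close>
      have less: "less_of S (?e s) (?e t)"
        using sat False d by (auto simp: diff_atom_def int_struct_def split: if_splits)
      show ?thesis
      proof (rule ccontr)
        assume "\<not> ?thesis"
        then have "less_of S (?e t) (add_of S (?e s) (num_of S d))"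
          using not_less_iff[of "?e t" "add_of S (?e s) (num_of S d)"] by simp
        then show False
          \<comment> \<open>Lying between \<open>?e s\<close> and \<open>?e s + d\<close>,
            \<open>?e t\<close> would be at a standard distance.\<close>
          using standard_difference[of "?e s" "?e t" d] less_imp_le[OF _ _ less] d(2) False
          by (auto simp: std_def)
      qed
    qed
  qed
qed

end

section \<open>Expanding maps from the integers into the model\<close>

lemma mono_retraction:
  fixes A :: "int set"
  assumes "finite A" "A \<noteq> {}"
  obtains r where "mono r" "\<And>z. r z \<in> A" "\<And>a. a \<in> A \<Longrightarrow> r a = a"
proof
  \<comment> \<open>Round down to the nearest element of \<open>A\<close>; the clamp sends
    everything below \<open>A\<close> to its minimum.\<close>
  define r where "r z = Max {a \<in> A. a \<le> max z (Min A)}" for z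
  have fin: "finite {a \<in> A. a \<le> max z (Min A)}" for z
    using assms by simp
  have ne: "{a \<in> A. a \<le> max z (Min A)} \<noteq> {}" for z
    using Min_in[OF assms] by (auto intro!: exI[of _ "Min A"])
  show "mono r"
    unfolding r_def by (intro monoI Max_mono) (use fin ne in auto)
  show "r z \<in> A" for z
    unfolding r_def using Max_in[OF fin ne] by blast
  show "r a = a" if "a \<in> A" for a
  proof -
    have "max a (Min A) = a"
      using that assms by simp
    with that fin[of a] show ?thesis
      unfolding r_def by (intro Max_eqI) auto
  qed
qed

lemma eval_ground: "ground t \<Longrightarrow> eval S \<sigma> t = eval S \<tau> t"
  unfolding ground_def by (induction t) auto

lemma self_in_subterms: "t \<in> subterms t"
  by (cases t) auto

lemma admissible_arg_cases:
  assumes "admissible_arg b t"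
  obtains "ground t" | x where "t = Var x" | x k where "b" "k \<ge> 0" "t = Add (Var x) (Num k)"
  using assms self_in_subterms[of t] unfolding admissible_arg_def by blast

text \<open>\<open>f\<close> commutes with evaluation on the terms in \<open>G\<close>, but need not
  commute with addition; for \<open>\<zeta> + k\<close> only the inequality
  \<open>f_expanding\<close> is available.\<close>

locale pullback = LIA_model S for S :: "('p, 'd) struct" +
  fixes \<pi> :: "'p \<Rightarrow> int" and f :: "int \<Rightarrow> 'd" and G :: "'p trm set"
  assumes f_in: "f z \<in> universe S"
    and f_expanding: "z \<le> w \<Longrightarrow> le_of S (add_of S (f z) (num_of S (w - z))) (f w)"
    and f_ground: "t \<in> G \<Longrightarrow> f (eval (int_struct \<pi>) \<sigma> t) = eval S (f \<circ> \<sigma>) t"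
begin

lemma f_less_iff: "less_of S (f z) (f w) \<longleftrightarrow> z < w"
proof -
  have less: "less_of S (f z) (f w)" if "z < w" for z w
    using less_if_add_num_le[OF f_in f_in, of "w - z" z w] f_expanding[of z w] that by simp
  have "\<not> less_of S (f z) (f w)" if "w \<le> z"
  proof (cases "w = z")
    case True
    then show ?thesis
      using not_less_iff[OF f_in f_in] le_refl[OF f_in] by blast
  next
    case False
    then show ?thesis
      using that less[of w z] not_less_iff[OF f_in f_in] less_imp_le[OF f_in f_in] by auto
  qed
  with less show ?thesis
    by (meson linorder_not_less)
qed

lemma f_le_iff: "le_of S (f z) (f w) \<longleftrightarrow> z \<le> w"
  using not_less_iff[OF f_in f_in] f_less_iff by (meson linorder_not_less)

lemma f_eq_iff: "f z = f w \<longleftrightarrow> z = w"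
  using f_less_iff by (metis linorder_neqE not_less_iff_gr_or_eq)

lemma eval_arg:
  assumes "admissible_arg False t" "t \<in> G \<or> \<not> ground t"
  shows "eval S (f \<circ> \<sigma>) t = f (eval (int_struct \<pi>) \<sigma> t)"
  using assms(1) by (rule admissible_arg_cases) (use assms(2) f_ground in auto)

lemma sat_lit_pullback:
  assumes adm: "admissible_lit L" and G: "\<And>t. t \<in> terms_lit L \<Longrightarrow> ground t \<Longrightarrow> t \<in> G"
    and sat: "sat_lit S (f \<circ> \<sigma>) L"
  shows "sat_lit (int_struct \<pi>) \<sigma> L"
proof -
  let ?i = "eval (int_struct \<pi>) \<sigma>" and ?s = "eval S (f \<circ> \<sigma>)"
  have arg: "?s t = f (?i t)" if "admissible_arg False t" "t \<in> terms_lit L" for t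
    using that G by (intro eval_arg) auto
  \<comment> \<open>Without sums, every argument evaluates into the image of \<open>f\<close>, an
    order embedding, so both polarities transfer.\<close>
  have atom: "sat_atom S (f \<circ> \<sigma>) A \<longleftrightarrow> sat_atom (int_struct \<pi>) \<sigma> A"
    if "admissible_atom False A" "L = Pos A \<or> L = Neg A" for A
    using that
    by (cases A)
      (auto simp: arg self_in_subterms f_eq_iff f_less_iff f_le_iff, auto simp: int_struct_def)
  show ?thesis
  proof (cases L)
    case (Neg A)
    then show ?thesis
      using atom[of A] adm sat by auto
  next
    case (Pos A)
    show ?thesis
    proof (cases "admissible_atom False A")
      case True
      then show ?thesis
        using atom[of A] Pos sat by auto
    next
      case False
      then obtain s t where A: "A = Less s t"
        using adm Pos by (cases A) auto
      with False adm Pos have s: "admissible_arg False s" and t: "admissible_arg True t"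
        and nt: "\<not> admissible_arg False t"
        by auto
      have "\<not> ground t \<and> (\<forall>x. t \<noteq> Var x)"
        using nt t by (auto simp: admissible_arg_def ground_def)
      then obtain x k where k: "k \<ge> 0" and tk: "t = Add (Var x) (Num k)"
        using t by (auto elim: admissible_arg_cases)
      have s_eq: "?s s = f (?i s)"
        using s by (intro arg) (auto simp: Pos A self_in_subterms)
      have less: "less_of S (f (?i s)) (add_of S (f (\<sigma> x)) (num_of S k))"
        using sat by (simp add: Pos A tk s_eq)
      \<comment> \<open>Otherwise
        \<open>f (\<sigma> x) + k \<le> f (\<sigma> x + k) \<le> f (?i s)\<close>, contradicting
        \<open>less\<close>; the first inequality uses \<open>k \<ge> 0\<close>.\<close>
      have "?i s < \<sigma> x + k"
      proof (rule ccontr)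
        assume "\<not> ?thesis"
        then have "le_of S (f (\<sigma> x + k)) (f (?i s))"
          by (simp add: f_le_iff)
        moreover have "le_of S (add_of S (f (\<sigma> x)) (num_of S k)) (f (\<sigma> x + k))"
          using f_expanding[of "\<sigma> x" "\<sigma> x + k"] k by simp
        ultimately have "le_of S (add_of S (f (\<sigma> x)) (num_of S k)) (f (?i s))"
          by (meson le_trans add_in num_in f_in)
        with less show False
          using not_less_iff[of "f (?i s)" "add_of S (f (\<sigma> x)) (num_of S k)"] f_in by simp
      qed
      then show ?thesis
        by (simp add: Pos A tk int_struct_def)
    qed
  qed
qed

end

lemma (in LIA_model) ex_pullback:
  assumes fin: "finite G" and ground: "\<And>t. t \<in> G \<Longrightarrow> ground t"
  shows "\<exists>\<pi> f. pullback S \<pi> f G"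
proof -
  define \<tau> where "\<tau> = (\<lambda>_ :: nat. num_of S 0)"
  have \<tau>: "\<tau> \<in> valuations S"
    by (simp add: \<tau>_def valuations_def)
  \<comment> \<open>Adding a numeral ensures a nonempty set to retract onto, even if
    \<open>G\<close> is empty.\<close>
  define G' where "G' = insert (Num 0) G"
  have "finite G'" "\<And>t. t \<in> G' \<Longrightarrow> ground t" "G' \<noteq> {}"
    using fin ground by (auto simp: G'_def ground_def)
  then obtain \<pi> where \<pi>: "\<And>s t \<sigma> d. s \<in> G' \<Longrightarrow> t \<in> G' \<Longrightarrow>
      d = eval (int_struct \<pi>) \<sigma> t - eval (int_struct \<pi>) \<sigma> s \<Longrightarrow>
      d \<ge> 0 \<Longrightarrow> le_of S (add_of S (eval S \<tau> s) (num_of S d)) (eval S \<tau> t)"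
    using contracting_parameters[OF _ _ \<tau>, of G'] by blast
  let ?i = "eval (int_struct \<pi>) undefined" and ?e = "eval S \<tau>"
  have U [simp]: "?e t \<in> universe S" for t
    using \<tau> by (rule eval_in)
  obtain r where r: "mono r" "\<And>z. r z \<in> ?i ` G'" "\<And>a. a \<in> ?i ` G' \<Longrightarrow> r a = a"
    using mono_retraction[of "?i ` G'"] \<open>finite G'\<close> \<open>G' \<noteq> {}\<close> by blast
  have "\<exists>t. t \<in> G' \<and> ?i t = r z" for z
    using r(2)[of z] by auto
  then obtain p where p: "\<And>z. p z \<in> G'" "\<And>z. ?i (p z) = r z"
    by metis
  \<comment> \<open>Start at the \<open>S\<close>-value of a ground term whose integer value is
    \<open>r z\<close> and shift by the remaining, possibly negative, integer offset.\<close>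
  define f where "f z = add_of S (?e (p z)) (num_of S (z - r z))" for z
  have "pullback S \<pi> f G"
  proof
    show "f z \<in> universe S" for z
      by (simp add: f_def)
    show "le_of S (add_of S (f z) (num_of S (w - z))) (f w)" if "z \<le> w" for z w
    proof -
      \<comment> \<open>Only the anchors need comparing: adding \<open>w - r w\<close> on both sides
        turns the total shift on the left into \<open>w - r z\<close>.\<close>
      have "le_of S (add_of S (?e (p z)) (num_of S (r w - r z))) (?e (p w))"
        using monoD[OF r(1) that] by (intro \<pi>[where \<sigma> = undefined]) (auto simp: p)
      then have "le_of S (add_of S (add_of S (?e (p z)) (num_of S (r w - r z))) (num_of S (w - r w))) (f w)"
        unfolding f_def by (intro add_num_mono) auto
      then show ?thesis
        by (simp add: f_def add_num_add_num)
    qed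
    show "f (eval (int_struct \<pi>) \<sigma> t) = eval S (f \<circ> \<sigma>) t" if "t \<in> G" for t \<sigma>
    proof -
      have t: "t \<in> G'" and rt: "r (?i t) = ?i t"
        using that r(3) by (auto simp: G'_def)
      \<comment> \<open>The chosen anchor may be another term with the same integer value;
        contraction with \<open>d = 0\<close> in both directions equates their values in
        \<open>S\<close>.\<close>
      have "le_of S (?e (p (?i t))) (?e t)" "le_of S (?e t) (?e (p (?i t)))"
        using \<pi>[of "p (?i t)" t 0 undefined] \<pi>[of t "p (?i t)" 0 undefined] t rt p
        by (simp_all add: add_num_0)
      then have "?e (p (?i t)) = ?e t"
        by (intro le_antisym) auto
      then have "f (?i t) = ?e t"
        by (simp add: f_def rt add_num_0)
      then show ?thesis
        using eval_ground[OF ground[OF that]] by metis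
    qed
  qed
  then show ?thesis
    by blast
qed

lemma satisfiable_theory_imp_satisfiable_int:
  fixes N :: "'p clause set"
  assumes adm: "\<forall>C\<in>N. admissible_clause C" and fin: "finite (ground_terms N)"
    and sat: "satisfiable_theory TYPE('d::infinite) N"
  shows "satisfiable_int N"
proof -
  obtain S :: "('p, 'd) struct" where S: "wf_struct S" "models_LIA_theory S"
    and true: "\<And>C. C \<in> N \<Longrightarrow> true_clause S C"
    using sat by (auto simp: satisfiable_theory_def)
  interpret LIA_model S
    using S by unfold_locales
  obtain \<pi> f where "pullback S \<pi> f (ground_terms N)"
    using ex_pullback[OF fin] by (auto simp: ground_terms_def)
  then interpret pullback S \<pi> f "ground_terms N" .
  have "true_clause (int_struct \<pi>) C" if C: "C \<in> N" for C
    unfolding true_clause_def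
  proof
    fix \<sigma> :: "nat \<Rightarrow> int"
    \<comment> \<open>The true literal may depend on \<open>\<sigma>\<close>, whereas
      \<open>\<pi>\<close> and \<open>f\<close> are fixed for all of \<open>N\<close>.\<close>
    have "f \<circ> \<sigma> \<in> valuations S"
      by (simp add: valuations_def f_in)
    then obtain L where L: "L \<in> set C" "sat_lit S (f \<circ> \<sigma>) L"
      using true[OF C] by (auto simp: true_clause_def)
    have "sat_lit (int_struct \<pi>) \<sigma> L"
    proof (rule sat_lit_pullback[OF _ _ L(2)])
      show "admissible_lit L"
        using adm C L by (auto simp: admissible_clause_def)
      show "t \<in> ground_terms N" if "t \<in> terms_lit L" "ground t" for t
        using that C L by (auto simp: ground_terms_def)
    qed
    with L show "\<exists>L\<in>set C. sat_lit (int_struct \<pi>) \<sigma> L" by blast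
  qed
  then show ?thesis
    by (auto simp: satisfiable_int_def)
qed

theorem theorem10:
  fixes N :: "'p clause set"
  assumes "\<forall>C\<in>N. admissible_clause C"
    and "finite (ground_terms N)"
  shows "satisfiable_int N \<longleftrightarrow> satisfiable_theory TYPE('d::infinite) N"
  using assms satisfiable_int_imp_satisfiable_theory satisfiable_theory_imp_satisfiable_int
  by blast

end
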